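(* Let $0<s<1$. For every $u\in \mathscr S(\mathbb R^n)$ one has $$(-\Delta)^s(u^2)(x) = 2\, u(x)\, (-\Delta)^s u(x) - 2\, \Gamma_{(s)}(u)(x)\qquad \text{for every } x\in\mathbb R^n.$$
   Context: $\mathscr S(\mathbb R^n)$ is the Schwartz space of rapidly decreasing smooth (real-valued) functions on $\mathbb R^n$. For $0<s<1$ the fractional Laplacian is defined by $$(-\Delta)^s u(x) = \frac{\gamma(n,s)}{2} \int_{\mathbb R^n} \frac{2 u(x) - u(x+y) - u(x-y)}{|y|^{n+2s}}\, dy,\qquad \gamma(n,s) = \frac{s 2^{2s} \Gamma\left(\frac{n+ 2s}{2}\right)}{\pi^{\frac n2} \Gamma(1-s)},$$ where $\Gamma(\cdot)$ is the Euler gamma function. The nonlocal carré du champ is $$\Gamma_{(s)}(u)(x) = \frac{\gamma(n,s)}{2} \int_{\mathbb R^n} \frac{(u(x) - u(y))^2}{|x-y|^{n + 2s}}\, dy .$$ *)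

theory Defs
  imports "HOL-Analysis.Analysis"
begin

definition partial_deriv :: "'n::finite \<Rightarrow> (real ^ 'n \<Rightarrow> real) \<Rightarrow> real ^ 'n \<Rightarrow> real" where
  "partial_deriv i f x = frechet_derivative f (at x) (axis i 1)"

text \<open>
  Partial derivatives of higher order are indexed by lists of coordinates. For smooth
  functions the order of differentiation is irrelevant, so lists carry the same information
  as multi-indices.
\<close>

definition iter_partial :: "'n::finite list \<Rightarrow> (real ^ 'n \<Rightarrow> real) \<Rightarrow> real ^ 'n \<Rightarrow> real" where
  "iter_partial is f = foldr partial_deriv is f"

text \<open>
  Every iterated partial derivative is Frechet differentiable on the whole space. In
  particular all of them exist as genuine derivatives and are continuous, so this is
  membership in $C^\infty$.
\<close>

definition smooth :: "(real ^ 'n::finite \<Rightarrow> real) \<Rightarrow> bool" where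
  "smooth f \<longleftrightarrow> (\<forall>is. iter_partial is f differentiable_on UNIV)"

definition schwartz_space :: "(real ^ 'n::finite \<Rightarrow> real) set" where
  "schwartz_space = {f. smooth f \<and>
     (\<forall>(\<alpha> :: 'n \<Rightarrow> nat) is.
        bounded (range (\<lambda>x. (\<Prod>i\<in>UNIV. (x $ i) ^ \<alpha> i) * iter_partial is f x)))}"

definition frac_const :: "nat \<Rightarrow> real \<Rightarrow> real" where
  "frac_const n s =
     s * 2 powr (2 * s) * Gamma ((real n + 2 * s) / 2) / (pi powr (real n / 2) * Gamma (1 - s))"

text \<open>
  In the two integrals below the integrand at the singularity is \<open>0 / 0 = 0\<close> by convention;
  this only concerns a null set.
\<close>

definition frac_laplacian :: "real \<Rightarrow> (real ^ 'n::finite \<Rightarrow> real) \<Rightarrow> real ^ 'n \<Rightarrow> real" where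
  "frac_laplacian s u x = frac_const CARD('n) s / 2 *
     (LINT y|lborel. (2 * u x - u (x + y) - u (x - y)) / norm y powr (real CARD('n) + 2 * s))"

definition carre_du_champ :: "real \<Rightarrow> (real ^ 'n::finite \<Rightarrow> real) \<Rightarrow> real ^ 'n \<Rightarrow> real" where
  "carre_du_champ s u x = frac_const CARD('n) s / 2 *
     (LINT y|lborel. (u x - u y)\<^sup>2 / norm (x - y) powr (real CARD('n) + 2 * s))"

end

theory Submission
  imports Defs
begin

text \<open>
  With \<open>a = u x\<close>, \<open>b = u (x + y)\<close>, \<open>c = u (x - y)\<close>, the identity is the pointwise equation
  \<open>2 a\<^sup>2 - b\<^sup>2 - c\<^sup>2 = 2 a (2 a - b - c) - (a - b)\<^sup>2 - (a - c)\<^sup>2\<close>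
  divided by \<open>norm y powr (n + 2 s)\<close> and integrated in \<open>y\<close>; the last two terms contribute the
  same integral. Splitting the integral needs absolute convergence: the numerators are bounded
  and quadratically small at \<open>0\<close>, and \<open>min 1 ((norm y)\<^sup>2) / norm y powr (n + 2 s)\<close> is integrable
  by comparison with a sum over dyadic balls.
\<close>

section \<open>Integrability of the singular kernel by dyadic decomposition\<close>

text \<open>Pointwise, \<open>f\<close> lies below the series of the constants \<open>c k\<close>
  times the indicators of the balls. Integrating term by term gives a finite sum, because the volume
  of a ball scales like \<open>r k ^ DIM('a)\<close>.\<close>

lemma integrable_lborel_if_dominated_by_balls:
  fixes f :: "'a::euclidean_space \<Rightarrow> real" and c r :: "nat \<Rightarrow> real"
  assumes [measurable]: "f \<in> borel_measurable borel"
    and nonneg: "\<And>x. 0 \<le> f x" "\<And>k. 0 \<le> c k" "\<And>k. 0 \<le> r k"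
    and dominated: "\<And>x. f x \<noteq> 0 \<Longrightarrow> \<exists>k. x \<in> ball 0 (r k) \<and> f x \<le> c k"
    and summable: "summable (\<lambda>k. c k * r k ^ DIM('a))"
  shows "integrable lborel f"
proof (rule integrableI_nonneg)
  let ?g = "\<lambda>k x. ennreal (c k) * indicator (ball (0::'a) (r k)) x"
  have [measurable]: "ball (0::'a) (r k) \<in> sets borel" for k
    by simp
  have "ennreal (f x) \<le> (\<Sum>k. ?g k x)" for x
  proof (cases "f x = 0")
    case False
    then obtain k where k: "x \<in> ball 0 (r k)" "f x \<le> c k"
      using dominated by blast
    then have "ennreal (f x) \<le> ?g k x"
      by (simp add: ennreal_leI)
    also have "?g k x = (\<Sum>i\<in>{k}. ?g i x)"
      by (subst sum.insert) simp_all
    also have "\<dots> \<le> (\<Sum>k. ?g k x)"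
      by (rule sum_le_suminf) auto
    finally show ?thesis .
  qed simp
  then have "(\<integral>\<^sup>+x. f x \<partial>lborel) \<le> (\<integral>\<^sup>+x. (\<Sum>k. ?g k x) \<partial>lborel)"
    by (intro nn_integral_mono)
  also have "\<dots> = (\<Sum>k. \<integral>\<^sup>+x. ?g k x \<partial>lborel)"
    by (rule nn_integral_suminf) measurable
  also have "\<dots> = (\<Sum>k. ennreal (unit_ball_vol DIM('a) * (c k * r k ^ DIM('a))))"
    using nonneg
    by (simp add: nn_integral_cmult_indicator emeasure_ball ennreal_mult'[symmetric] mult_ac)
  also have "\<dots> < \<infinity>"
    unfolding infinity_ennreal_def less_top[symmetric] using nonneg
    by (intro ennreal_suminf_neq_top summable_mult summable) simp_all
  finally show "(\<integral>\<^sup>+x. f x \<partial>lborel) < \<infinity>" .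
qed (use nonneg in auto)

lemma summable_powr_linear:
  fixes a b :: real
  assumes "a < 0"
  shows "summable (\<lambda>k. 2 powr (real k * a + b))"
proof -
  have "2 powr (real k * a + b) = 2 powr b * (2 powr a) ^ k" for k
    by (simp add: powr_add powr_powr[symmetric] powr_realpow[symmetric] mult.commute)
  moreover have "2 powr a < 1"
    using assms powr_less_mono[of a 0 2] by simp
  ultimately show ?thesis
    by (simp add: summable_mult summable_geometric)
qed

text \<open>Near \<open>0\<close> the kernel is \<open>norm y powr (2 - 2 * s - DIM('a))\<close>,
  which is integrable since \<open>s < 1\<close>; away from \<open>0\<close> it is
  \<open>norm y powr (- DIM('a) - 2 * s)\<close>, which is integrable since \<open>s > 0\<close>.
  The two regions are treated separately.\<close>

lemma integrable_fractional_kernel: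
  fixes s :: real
  assumes "0 < s" "s < 1"
  shows "integrable lborel
    (\<lambda>y::'a::euclidean_space. min 1 ((norm y)\<^sup>2) / norm y powr (real DIM('a) + 2 * s))"
    (is "integrable lborel ?f")
proof -
  define n where "n = DIM('a)"
  define q where "q = real n + 2 * s"
  have q: "q > 0" using assms by (simp add: q_def add_nonneg_pos)
  \<comment> \<open>With norms written as powers of two, every comparison below reduces to one of
    exponents.\<close>
  define L where "L y = log 2 (norm y)" for y :: 'a
  have norm_eq: "norm y = 2 powr L y" if "y \<noteq> 0" for y
    using that by (simp add: L_def)
  have f_eq: "?f y = min 1 (2 powr (2 * L y)) * 2 powr (- L y * q)" if "y \<noteq> 0" for y
    using that by (simp add: norm_eq powr_powr powr_minus power2_eq_square q_def n_def
        divide_inverse flip: powr_add)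
  have inner: "integrable lborel (\<lambda>y. indicator (ball 0 1) y * ?f y)" (is "integrable _ ?g")
  proof (rule integrable_lborel_if_dominated_by_balls)
    \<comment> \<open>On the shell where \<open>norm y\<close> lies between
      \<open>2 powr (- k - 1)\<close> and \<open>2 powr (- k)\<close>, the two factors of
      \<open>?c k\<close> bound the numerator and the reciprocal of the denominator.\<close>
    let ?c = "\<lambda>k. 2 powr (- 2 * real k) * 2 powr ((real k + 1) * q)" and ?r = "\<lambda>k. 2 powr (- real k)"
    have eq: "?c k * ?r k ^ DIM('a) = 2 powr (real k * (2 * s - 2) + q)" for k
      by (simp add: powr_realpow[symmetric] powr_powr q_def n_def algebra_simps
          flip: powr_add)
    show "summable (\<lambda>k. ?c k * ?r k ^ DIM('a))"
      unfolding eq using assms by (intro summable_powr_linear) simp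
    show "\<exists>k. y \<in> ball 0 (?r k) \<and> ?g y \<le> ?c k" if "?g y \<noteq> 0" for y
    proof -
      have y: "y \<noteq> 0" "norm y < 1"
        using that by (auto simp: indicator_def split: if_splits)
      then have "L y < 0" by (simp add: L_def)
      \<comment> \<open>Ceiling minus one rather than floor: the balls are open, so
        \<open>k < - L y\<close> must be strict even when \<open>norm y\<close> is a power of
        two.\<close>
      define k where "k = nat (\<lceil>- L y\<rceil> - 1)"
      have k: "real k < - L y" "- L y \<le> real k + 1"
        using \<open>L y < 0\<close> unfolding k_def by linarith+
      have "?g y \<le> 2 powr (2 * L y) * 2 powr (- L y * q)"
        using y by (simp add: f_eq mult_right_mono)
      also have "\<dots> \<le> 2 powr (- 2 * real k) * 2 powr ((real k + 1) * q)"
      proof -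
        have "2 * L y \<le> - 2 * real k" and "- L y * q \<le> (real k + 1) * q"
          using k q by (simp, intro mult_right_mono) auto
        then show ?thesis
          by (intro mult_mono[OF powr_mono powr_mono]) auto
      qed
      finally show ?thesis
        using k y by (auto simp: norm_eq intro!: exI[of _ k])
    qed
  qed (measurable, auto)
  have outer: "integrable lborel (\<lambda>y. indicator (- ball 0 1) y * ?f y)" (is "integrable _ ?g")
  proof (rule integrable_lborel_if_dominated_by_balls)
    \<comment> \<open>Here the shells are given by
      \<open>2 powr k \<le> norm y < 2 powr (k + 1)\<close>, and the numerator is at most
      \<open>1\<close>.\<close>
    let ?c = "\<lambda>k. 2 powr (- real k * q)" and ?r = "\<lambda>k. 2 powr (real k + 1)"
    have eq: "?c k * ?r k ^ DIM('a) = 2 powr (real k * (- 2 * s) + real n)" for k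
      by (simp add: powr_realpow[symmetric] powr_powr q_def n_def algebra_simps
          flip: powr_add)
    show "summable (\<lambda>k. ?c k * ?r k ^ DIM('a))"
      unfolding eq using assms by (intro summable_powr_linear) simp
    show "\<exists>k. y \<in> ball 0 (?r k) \<and> ?g y \<le> ?c k" if "?g y \<noteq> 0" for y
    proof -
      have y: "y \<noteq> 0" "norm y \<ge> 1"
        using that by (auto simp: indicator_def split: if_splits)
      then have "L y \<ge> 0" by (simp add: L_def)
      define k where "k = nat \<lfloor>L y\<rfloor>"
      have k: "real k \<le> L y" "L y < real k + 1"
        using \<open>L y \<ge> 0\<close> unfolding k_def by linarith+
      have "?g y = ?f y"
        using y by simp
      also have "\<dots> = min 1 (2 powr (2 * L y)) * 2 powr (- L y * q)"
        using y(1) by (rule f_eq)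
      also have "\<dots> \<le> 2 powr (- L y * q)"
        by (intro mult_left_le_one_le) auto
      also have "\<dots> \<le> ?c k"
        using k q by (intro powr_mono mult_right_mono) auto
      finally show ?thesis
        using k y by (auto simp: norm_eq intro!: exI[of _ k])
    qed
  qed (measurable, auto)
  have "?f = (\<lambda>y. indicator (ball 0 1) y * ?f y + indicator (- ball 0 1) y * ?f y)"
    by (auto simp: indicator_def fun_eq_iff)
  then show ?thesis
    using Bochner_Integration.integrable_add[OF inner outer] by simp
qed

text \<open>The two bounds combine to \<open>max A B * min 1 ((norm y)\<^sup>2)\<close>, which
  reduces the claim to the model kernel.\<close>

lemma integrable_div_fractional_kernel:
  fixes g :: "'a::euclidean_space \<Rightarrow> real"
  assumes "0 < s" "s < 1" and [measurable]: "g \<in> borel_measurable borel"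
    and small: "\<And>y. \<bar>g y\<bar> \<le> A * (norm y)\<^sup>2" and large: "\<And>y. \<bar>g y\<bar> \<le> B"
  shows "integrable lborel (\<lambda>y. g y / norm y powr (real DIM('a) + 2 * s))"
proof (rule Bochner_Integration.integrable_bound)
  let ?C = "max A B"
  show "integrable lborel (\<lambda>y::'a. ?C * (min 1 ((norm y)\<^sup>2) / norm y powr (real DIM('a) + 2 * s)))"
    using assms by (intro integrable_mult_right integrable_fractional_kernel)
  show "AE y in lborel. norm (g y / norm y powr (real DIM('a) + 2 * s)) \<le>
      norm (?C * (min 1 ((norm y)\<^sup>2) / norm y powr (real DIM('a) + 2 * s)))"
  proof (rule AE_I2)
    fix y :: 'a
    have "B \<ge> 0" using large[of 0] by linarith
    have "\<bar>g y\<bar> \<le> ?C * 1"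
      using large[of y] by simp
    moreover have "\<bar>g y\<bar> \<le> ?C * (norm y)\<^sup>2"
      using small[of y] by (rule order_trans) (simp add: mult_right_mono)
    ultimately have "\<bar>g y\<bar> \<le> ?C * min 1 ((norm y)\<^sup>2)"
      by (simp add: min_def)
    then show "norm (g y / norm y powr (real DIM('a) + 2 * s)) \<le>
      norm (?C * (min 1 ((norm y)\<^sup>2) / norm y powr (real DIM('a) + 2 * s)))"
      using \<open>B \<ge> 0\<close> by (simp add: abs_mult divide_right_mono)
  qed
qed auto

text \<open>Translations and point reflections preserve Lebesgue measure. This identifies the
  integrals of the two squared differences with the one in \<open>carre_du_champ\<close>.\<close>

lemma integral_lborel_reflect:
  fixes F :: "'a::euclidean_space \<Rightarrow> real"
  assumes [measurable]: "F \<in> borel_measurable borel"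
  shows "(LINT y|lborel. F (x + y)) = integral\<^sup>L lborel F"
    and "(LINT y|lborel. F (x - y)) = integral\<^sup>L lborel F"
proof -
  \<comment> \<open>The factor \<open>c\<close> is \<open>1\<close> or \<open>-1\<close>, so the
    Jacobian is \<open>1\<close> and one argument serves both claims.\<close>
  have eq: "distr lborel borel (\<lambda>y. x + c *\<^sub>R y) = (lborel :: 'a measure)" if "\<bar>c\<bar> = 1" for c
    using lborel_affine[of c x] that by (auto simp: density_1)
  have "(LINT y|lborel. F (x + c *\<^sub>R y)) = integral\<^sup>L lborel F" if "\<bar>c\<bar> = 1" for c
    using integral_distr[of "\<lambda>y. x + c *\<^sub>R y" lborel borel F] eq[OF that] by simp
  from this[of 1] this[of "-1"] show "(LINT y|lborel. F (x + y)) = integral\<^sup>L lborel F"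
    and "(LINT y|lborel. F (x - y)) = integral\<^sup>L lborel F"
    by simp_all
qed

section \<open>Difference estimates for Schwartz functions\<close>

lemma frechet_derivative_eq_sum_partial_deriv:
  assumes "f differentiable (at x)"
  shows "frechet_derivative f (at x) h = (\<Sum>i\<in>UNIV. h $ i * partial_deriv i f x)"
proof -
  have lin: "linear (frechet_derivative f (at x))"
    using assms by (rule linear_frechet_derivative)
  have "frechet_derivative f (at x) h =
      frechet_derivative f (at x) (\<Sum>i\<in>UNIV. (h $ i) *\<^sub>R axis i 1)"
    by (simp add: basis_expansion flip: scalar_mult_eq_scaleR)
  then show ?thesis
    using lin by (simp add: linear_sum linear_cmul partial_deriv_def)
qed

text \<open>The fold applies the last list entry first, so a derivative already taken is appended at
  the end of the list. Bounds for Schwartz functions thereby carry over to their partial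
  derivatives.\<close>

lemma schwartz_space_partial_deriv:
  assumes "f \<in> schwartz_space"
  shows "partial_deriv i f \<in> schwartz_space"
proof -
  have "iter_partial is (partial_deriv i f) = iter_partial (is @ [i]) f" for "is"
    by (simp add: iter_partial_def)
  with assms show ?thesis
    by (auto simp: schwartz_space_def smooth_def)
qed

lemma schwartz_space_differentiable:
  assumes "f \<in> schwartz_space"
  shows "f differentiable (at x)"
proof -
  have "iter_partial [] f differentiable_on UNIV"
    using assms unfolding schwartz_space_def smooth_def by blast
  then show ?thesis
    by (simp add: iter_partial_def differentiable_on_def)
qed

lemma schwartz_space_bounded:
  assumes "f \<in> schwartz_space"
  obtains B where "B \<ge> 0" "\<And>x. \<bar>f x\<bar> \<le> B"
proof -
  have "bounded (range (\<lambda>x. (\<Prod>i\<in>UNIV. (x $ i) ^ \<alpha> i) * iter_partial is f x))" for \<alpha> "is"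
    using assms by (simp add: schwartz_space_def)
  from this[of "\<lambda>_. 0" "[]"] have "bounded (range f)"
    by (simp add: iter_partial_def)
  then obtain B where "\<And>x. \<bar>f x\<bar> \<le> B"
    by (auto simp: bounded_iff)
  moreover from this[of 0] have "B \<ge> 0"
    by linarith
  ultimately show ?thesis
    using that by blast
qed

text \<open>The partial derivatives are bounded, so the mean value inequality applies with the sum
  of their bounds.\<close>

lemma schwartz_space_lipschitz:
  assumes "f \<in> schwartz_space"
  obtains M where "M \<ge> 0" "\<And>x y. \<bar>f x - f y\<bar> \<le> M * norm (x - y)"
proof -
  have "\<exists>B\<ge>0. \<forall>x. \<bar>partial_deriv i f x\<bar> \<le> B" for i
    using schwartz_space_bounded[OF schwartz_space_partial_deriv[OF assms, of i]] by metis
  then obtain B where B: "\<And>i. B i \<ge> 0" "\<And>i x. \<bar>partial_deriv i f x\<bar> \<le> B i"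
    by metis
  let ?M = "\<Sum>i\<in>UNIV. B i"
  have diff: "f differentiable (at x)" for x
    using assms by (rule schwartz_space_differentiable)
  have "\<bar>frechet_derivative f (at x) h\<bar> \<le> ?M * norm h" for x h
  proof -
    have "\<bar>frechet_derivative f (at x) h\<bar> \<le> (\<Sum>i\<in>UNIV. \<bar>h $ i * partial_deriv i f x\<bar>)"
      unfolding frechet_derivative_eq_sum_partial_deriv[OF diff] by (rule sum_abs)
    also have "\<dots> \<le> (\<Sum>i\<in>UNIV. norm h * B i)"
      unfolding abs_mult by (intro sum_mono mult_mono B component_le_norm_cart) auto
    finally show ?thesis
      by (simp add: sum_distrib_left mult.commute[of _ "norm h"])
  qed
  then have "onorm (frechet_derivative f (at x)) \<le> ?M" for x
    by (intro onorm_le) (auto simp: mult.commute)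
  moreover have "(f has_derivative frechet_derivative f (at x)) (at x)" for x
    using diff frechet_derivative_works by blast
  ultimately have "\<bar>f x - f y\<bar> \<le> ?M * norm (x - y)" for x y
    using differentiable_bound[of UNIV f "\<lambda>x. frechet_derivative f (at x)" ?M y x]
    by (simp add: norm_minus_commute)
  then show ?thesis
    using that[of ?M] B by (simp add: sum_nonneg)
qed

text \<open>
  On \<open>[0, 1]\<close> the function \<open>t \<mapsto> f (x + t y) + f (x - t y)\<close> has a derivative of size \<open>O(t \<bar>y\<bar>\<^sup>2)\<close>, because
  the partial derivatives of \<open>f\<close> are Lipschitz.
\<close>

lemma schwartz_space_second_difference:
  assumes "f \<in> schwartz_space"
  obtains A where "\<And>x y. \<bar>2 * f x - f (x + y) - f (x - y)\<bar> \<le> A * (norm y)\<^sup>2"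
proof -
  have "\<exists>M\<ge>0. \<forall>x y. \<bar>partial_deriv i f x - partial_deriv i f y\<bar> \<le> M * norm (x - y)" for i
    using schwartz_space_lipschitz[OF schwartz_space_partial_deriv[OF assms, of i]] by metis
  then obtain M where M: "\<And>i. M i \<ge> 0"
    "\<And>i x y. \<bar>partial_deriv i f x - partial_deriv i f y\<bar> \<le> M i * norm (x - y)"
    by metis
  \<comment> \<open>The factor \<open>2\<close> arises because \<open>x + t *\<^sub>R y\<close> and
    \<open>x - t *\<^sub>R y\<close> are at most \<open>2 * norm y\<close> apart.\<close>
  let ?A = "\<Sum>i\<in>UNIV. 2 * M i"
  let ?D = "\<lambda>z. frechet_derivative f (at z)"
  have diff: "f differentiable (at x)" for x
    using assms by (rule schwartz_space_differentiable)
  have D: "(f has_derivative ?D z) (at z)" for z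
    using diff frechet_derivative_works by blast
  have "\<bar>2 * f x - f (x + y) - f (x - y)\<bar> \<le> ?A * (norm y)\<^sup>2" for x y
  proof -
    define g where "g t = f (x + t *\<^sub>R y) + f (x - t *\<^sub>R y)" for t
    define g' where "g' t = ?D (x + t *\<^sub>R y) y - ?D (x - t *\<^sub>R y) y" for t
    have "(g has_derivative (\<lambda>h. h * g' t)) (at t)" for t
    proof -
      have "((\<lambda>t. f (x + t *\<^sub>R y)) has_derivative (\<lambda>h. ?D (x + t *\<^sub>R y) (h *\<^sub>R y))) (at t)"
        by (rule has_derivative_compose[OF _ D]) (auto intro!: derivative_eq_intros)
      moreover have "((\<lambda>t. f (x - t *\<^sub>R y)) has_derivative (\<lambda>h. ?D (x - t *\<^sub>R y) (- (h *\<^sub>R y)))) (at t)"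
        by (rule has_derivative_compose[OF _ D]) (auto intro!: derivative_eq_intros)
      ultimately show ?thesis
        unfolding g_def g'_def
        by (rule has_derivative_eq_rhs[OF has_derivative_add])
          (simp add: fun_eq_iff linear_cmul linear_neg linear_frechet_derivative[OF diff] algebra_simps)
    qed
    then have "(g has_real_derivative g' t) (at t)" for t
      by (simp add: has_field_derivative_def mult_commute_abs)
    \<comment> \<open>As \<open>g 0 = 2 * f x\<close>, the increment \<open>g 1 - g 0\<close> is the
      negative of the second difference.\<close>
    then obtain t where t: "0 < t" "t < 1" "g 1 - g 0 = (1 - 0) * g' t"
      using MVT2[of 0 1 g g'] by auto
    have "\<bar>g' t\<bar> = \<bar>\<Sum>i\<in>UNIV. y $ i *
        (partial_deriv i f (x + t *\<^sub>R y) - partial_deriv i f (x - t *\<^sub>R y))\<bar>"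
      unfolding g'_def frechet_derivative_eq_sum_partial_deriv[OF diff]
      by (simp add: right_diff_distrib sum_subtractf)
    also have "\<dots> \<le> (\<Sum>i\<in>UNIV. \<bar>y $ i *
        (partial_deriv i f (x + t *\<^sub>R y) - partial_deriv i f (x - t *\<^sub>R y))\<bar>)"
      by (rule sum_abs)
    also have "\<dots> \<le> (\<Sum>i\<in>UNIV. norm y * (M i * (2 * norm y)))"
    proof -
      have "norm ((x + t *\<^sub>R y) - (x - t *\<^sub>R y)) = norm ((2 * t) *\<^sub>R y)"
        by (simp add: scaleR_2 flip: scaleR_scaleR)
      also have "\<dots> \<le> 2 * norm y"
        using t by (simp add: mult_left_le_one_le)
      finally have le: "norm ((x + t *\<^sub>R y) - (x - t *\<^sub>R y)) \<le> 2 * norm y" .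
      have "\<bar>partial_deriv i f (x + t *\<^sub>R y) - partial_deriv i f (x - t *\<^sub>R y)\<bar> \<le> M i * (2 * norm y)" for i
        by (rule order_trans[OF M(2)]) (intro mult_left_mono le M(1))
      then show ?thesis
        unfolding abs_mult by (intro sum_mono mult_mono component_le_norm_cart) auto
    qed
    also have "\<dots> = ?A * (norm y)\<^sup>2"
      by (simp add: sum_distrib_left sum_distrib_right power2_eq_square mult_ac)
    finally show ?thesis
      using t(3) by (simp add: g_def)
  qed
  then show ?thesis
    using that by blast
qed

section \<open>The pointwise identity and its integration\<close>

theorem proposition1p1:
  fixes s :: real and u :: "real ^ 'n::finite \<Rightarrow> real"
  assumes "0 < s" and "s < 1"
    and "u \<in> schwartz_space"
  shows "\<forall>x. frac_laplacian s (\<lambda>y. (u y)\<^sup>2) x =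
    2 * u x * frac_laplacian s u x - 2 * carre_du_champ s u x"
proof
  fix x
  note s = assms(1,2) and u = assms(3)
  let ?q = "real CARD('n) + 2 * s"
  have "continuous_on UNIV u"
    using schwartz_space_differentiable[OF u]
    by (simp add: continuous_at_imp_continuous_on differentiable_imp_continuous_within)
  then have [measurable]: "u \<in> borel_measurable borel"
    by (rule borel_measurable_continuous_onI)
  obtain B where B: "B \<ge> 0" "\<And>z. \<bar>u z\<bar> \<le> B"
    using schwartz_space_bounded[OF u] by blast
  obtain M where M: "M \<ge> 0" "\<And>y z. \<bar>u y - u z\<bar> \<le> M * norm (y - z)"
    using schwartz_space_lipschitz[OF u] by blast
  obtain A where A: "\<And>z y. \<bar>2 * u z - u (z + y) - u (z - y)\<bar> \<le> A * (norm y)\<^sup>2"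
    using schwartz_space_second_difference[OF u] by blast
  define S where "S y = (2 * u x - u (x + y) - u (x - y)) / norm y powr ?q" for y
  define F where "F y = (u x - u y)\<^sup>2 / norm (x - y) powr ?q" for y
  have [measurable]: "F \<in> borel_measurable borel"
    unfolding F_def by measurable
  have int_S: "integrable lborel S"
  proof -
    have "\<bar>2 * u x - u (x + y) - u (x - y)\<bar> \<le> 4 * B" for y
      using B(2)[of x] B(2)[of "x + y"] B(2)[of "x - y"] by linarith
    then show ?thesis
      using integrable_div_fractional_kernel[OF s, of "\<lambda>y. 2 * u x - u (x + y) - u (x - y)" A "4 * B"] A
      by (simp add: S_def[abs_def])
  qed
  \<comment> \<open>Used for \<open>h y = x + y\<close> and \<open>h y = x - y\<close>. The
    Lipschitz bound controls the square near \<open>0\<close>, the uniform bound controls it far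
    away.\<close>
  have int_square: "integrable lborel (\<lambda>y. (u x - u (h y))\<^sup>2 / norm y powr ?q)"
    if [measurable]: "h \<in> borel_measurable borel" and h: "\<And>y. norm (x - h y) = norm y"
    for h :: "real ^ 'n \<Rightarrow> real ^ 'n"
  proof -
    have "\<bar>(u x - u (h y))\<^sup>2\<bar> \<le> M\<^sup>2 * (norm y)\<^sup>2" for y
      using power_mono[OF M(2)[of x "h y"], of 2] by (simp add: h power_mult_distrib)
    moreover have "\<bar>(u x - u (h y))\<^sup>2\<bar> \<le> (2 * B)\<^sup>2" for y
      using power_mono[of "\<bar>u x - u (h y)\<bar>" "2 * B" 2] B(2)[of x] B(2)[of "h y"] by simp
    ultimately show ?thesis
      using integrable_div_fractional_kernel[OF s, of "\<lambda>y. (u x - u (h y))\<^sup>2" "M\<^sup>2" "(2 * B)\<^sup>2"]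
      by simp
  qed
  have int_plus: "integrable lborel (\<lambda>y. F (x + y))"
    and int_minus: "integrable lborel (\<lambda>y. F (x - y))"
    using int_square[of "\<lambda>y. x + y"] int_square[of "\<lambda>y. x - y"] by (simp_all add: F_def)
  \<comment> \<open>This includes \<open>y = 0\<close>, where every quotient is \<open>0\<close> by
    the convention for division by zero.\<close>
  have "(2 * (u x)\<^sup>2 - (u (x + y))\<^sup>2 - (u (x - y))\<^sup>2) / norm y powr ?q =
      2 * u x * S y - (F (x + y) + F (x - y))" for y
  proof -
    have "2 * (u x)\<^sup>2 - (u (x + y))\<^sup>2 - (u (x - y))\<^sup>2 =
        2 * u x * (2 * u x - u (x + y) - u (x - y)) - ((u x - u (x + y))\<^sup>2 + (u x - u (x - y))\<^sup>2)"
      by (simp add: power2_eq_square algebra_simps)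
    then show ?thesis
      by (simp only:)
        (simp add: S_def F_def diff_divide_distrib[of "2 * u x * _"] add_divide_distrib)
  qed
  then have "(LINT y|lborel. (2 * (u x)\<^sup>2 - (u (x + y))\<^sup>2 - (u (x - y))\<^sup>2) / norm y powr ?q) =
      (LINT y|lborel. 2 * u x * S y - (F (x + y) + F (x - y)))"
    by simp
  \<comment> \<open>Integrability of all three terms permits the splitting; both shifted copies of
    \<open>F\<close> have the integral of \<open>F\<close>, hence the factor
    \<open>2\<close>.\<close>
  also have "\<dots> = 2 * u x * integral\<^sup>L lborel S - 2 * integral\<^sup>L lborel F"
    using int_S int_plus int_minus by (simp add: integral_lborel_reflect)
  finally have eq: "(LINT y|lborel. (2 * (u x)\<^sup>2 - (u (x + y))\<^sup>2 - (u (x - y))\<^sup>2) / norm y powr ?q) =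
      2 * u x * integral\<^sup>L lborel S - 2 * integral\<^sup>L lborel F" .
  show "frac_laplacian s (\<lambda>y. (u y)\<^sup>2) x =
      2 * u x * frac_laplacian s u x - 2 * carre_du_champ s u x"
    unfolding frac_laplacian_def carre_du_champ_def eq S_def[abs_def, symmetric] F_def[abs_def, symmetric]
    by (simp add: algebra_simps)
qed

end
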